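(* Let $\tau\in(0,1)$ and $i\in(0,1)$. The mean-expectile valuation $\rho^{(\ell_\tau)}:\mathcal{C}\to\mathbb{R}$, defined by $$\rho^{(\ell_\tau)}(S)=\boldsymbol{\theta}_S\cdot\mathbf{y}+i\,\boldsymbol{\eta}^{(\ell_\tau)}_S\cdot\mathbf{y},$$ $$\boldsymbol{\theta}_S=\arg\min_{\boldsymbol{\beta}\in\mathcal{B}}\mathbb{E}\left[(S-\boldsymbol{\beta}\cdot\mathbf{Y})^2\right],\qquad \boldsymbol{\eta}^{(\ell_\tau)}_S=\arg\min_{\boldsymbol{\beta}\in\mathcal{B}}\mathbb{E}\left[\ell_\tau(S-\boldsymbol{\theta}_S\cdot\mathbf{Y}-\boldsymbol{\beta}\cdot\mathbf{Y})\right],$$ where $\ell_\tau(x)=\tau(\max(x,0))^2+(1-\tau)(\max(-x,0))^2$, is positive homogeneous and fair (that is, market-consistent and actuarial).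
   Context: One-period market. $(\Omega,\mathcal{F},\mathbb{P})$ is a probability space and $\mathcal{C}\subseteq L^2(\Omega,\mathcal{F},\mathbb{P})$ is the set of all claims with maturity $1$. There is a risk-free asset (asset $0$) with deterministic interest rate $r\ge 0$ and $n$ risky assets. Asset values at time $0$ are $\mathbf{y}=(1,y_1,\ldots,y_n)$ with $y_i\ge 0$, and at time $1$ they are $\mathbf{Y}=(Y_0,Y_1,\ldots,Y_n)$ with $Y_0=e^r$ and $Y_i\in\mathcal{C}$. The set of trading strategies is $\mathcal{B}=\mathbb{R}^{n+1}$; a strategy $\boldsymbol{\beta}=(\beta_0,\ldots,\beta_n)$ has value $\boldsymbol{\beta}\cdot\mathbf{y}=\sum_{i=0}^n\beta_i y_i$ at time $0$ and $\boldsymbol{\beta}\cdot\mathbf{Y}=\sum_{i=0}^n\beta_i Y_i$ at time $1$. Assets are non-redundant: $\boldsymbol{\beta}\cdot\mathbf{Y}=0$ $\mathbb{P}$-a.s. if and only if $\boldsymbol{\beta}=(0,\ldots,0)$; this ensures that the quadratic hedging problem has a unique solution. A claim is hedgeable if it equals $\boldsymbol{\beta}\cdot\mathbf{Y}$ for some $\boldsymbol{\beta}\in\mathcal{B}$. $\mathcal{C}^\perp\subseteq\mathcal{C}$ is the class of claims independent of the vector $\mathbf{Y}$. The constant $i$ is the cost-of-capital rate. A valuation is a mapping $\rho:\mathcal{C}\to\mathbb{R}$ with $\rho(0)=0$ and $\rho(S+a)=\rho(S)+e^{-r}a$ for all $S\in\mathcal{C}$, $a\in\mathbb{R}$. A valuation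 $\rho$ is: - positive homogeneous if $\rho(\lambda S)=\lambda\rho(S)$ for all $S\in\mathcal{C}$ and $\lambda\ge 0$; - market-consistent if $\rho(S+S^h)=\rho(S)+\boldsymbol{\beta}\cdot\mathbf{y}$ for all $S\in\mathcal{C}$ and every hedgeable payoff $S^h=\boldsymbol{\beta}\cdot\mathbf{Y}$; - actuarial if $\rho(S^\perp)=e^{-r}\mathbb{E}[S^\perp]+\mathrm{RM}(S^\perp)$ for all $S^\perp\in\mathcal{C}^\perp$, where $\mathrm{RM}:\mathcal{C}^\perp\to\mathbb{R}$ is a mapping that does not depend on the current asset prices $\mathbf{y}$; - fair if it is market-consistent and actuarial. These identities are required whenever all the claims appearing in them belong to $\mathcal{C}$. *)

theory Defs
  imports "HOL-Probability.Probability"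
begin

text \<open>
  Vectors indexed by the assets: \<open>None\<close> is the risk-free asset, and \<open>Some j\<close> with
  \<open>j :: 'n\<close> are the \<open>n = CARD('n)\<close> risky assets. Trading strategies range over the whole type.
\<close>
type_synonym 'n assets = "real ^ ('n option)"

definition square_integrable :: "'a measure \<Rightarrow> ('a \<Rightarrow> real) set" where
  "square_integrable M = {S \<in> borel_measurable M. integrable M (\<lambda>\<omega>. (S \<omega>)\<^sup>2)}"

definition admissible_prices :: "('n::finite) assets set" where
  "admissible_prices = {y. y $ None = 1 \<and> (\<forall>j. 0 \<le> y $ Some j)}"

definition non_redundant :: "'a measure \<Rightarrow> ('a \<Rightarrow> ('n::finite) assets) \<Rightarrow> bool" where
  "non_redundant M Y \<longleftrightarrow> (\<forall>\<beta>. (AE \<omega> in M. \<beta> \<bullet> Y \<omega> = 0) \<longleftrightarrow> \<beta> = 0)"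

text \<open>
  The library's \<open>indep_var\<close> needs random variables with values in the same type; here
  independence is that of the generated \<open>\<sigma>\<close>-algebras.
\<close>
definition orthogonal_claims ::
    "'a measure \<Rightarrow> ('a \<Rightarrow> real) set \<Rightarrow> ('a \<Rightarrow> ('n::finite) assets) \<Rightarrow> ('a \<Rightarrow> real) set" where
  "orthogonal_claims M C Y = {S \<in> C.
     prob_space.indep_set M (sets (vimage_algebra (space M) S borel))
       (sets (vimage_algebra (space M) Y borel))}"

text \<open>
  Claims are represented by functions, so a map on a subset of \<open>L\<^sup>2\<close> has to take equal
  values on almost surely equal representatives. The set \<open>C\<close> of claims need not be closed under
  the operations below; each identity is required only if its claims belong to \<open>C\<close>.
\<close>
definition valuation ::
    "'a measure \<Rightarrow> real \<Rightarrow> ('a \<Rightarrow> real) set \<Rightarrow> (('a \<Rightarrow> real) \<Rightarrow> real) \<Rightarrow> bool" where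
  "valuation M r C \<rho> \<longleftrightarrow>
     (\<forall>S\<in>C. \<forall>T\<in>C. (AE \<omega> in M. S \<omega> = T \<omega>) \<longrightarrow> \<rho> S = \<rho> T) \<and>
     ((\<lambda>\<omega>. 0) \<in> C \<longrightarrow> \<rho> (\<lambda>\<omega>. 0) = 0) \<and>
     (\<forall>S\<in>C. \<forall>a. (\<lambda>\<omega>. S \<omega> + a) \<in> C \<longrightarrow> \<rho> (\<lambda>\<omega>. S \<omega> + a) = \<rho> S + exp (- r) * a)"

definition positive_homogeneous ::
    "('a \<Rightarrow> real) set \<Rightarrow> (('a \<Rightarrow> real) \<Rightarrow> real) \<Rightarrow> bool" where
  "positive_homogeneous C \<rho> \<longleftrightarrow>
     (\<forall>S\<in>C. \<forall>c\<ge>0. (\<lambda>\<omega>. c * S \<omega>) \<in> C \<longrightarrow> \<rho> (\<lambda>\<omega>. c * S \<omega>) = c * \<rho> S)"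

definition market_consistent ::
    "'a measure \<Rightarrow> ('a \<Rightarrow> real) set \<Rightarrow> ('a \<Rightarrow> ('n::finite) assets) \<Rightarrow> 'n assets \<Rightarrow>
      (('a \<Rightarrow> real) \<Rightarrow> real) \<Rightarrow> bool" where
  "market_consistent M C Y y \<rho> \<longleftrightarrow>
     (\<forall>S\<in>C. \<forall>H \<beta>. (AE \<omega> in M. H \<omega> = \<beta> \<bullet> Y \<omega>) \<and> (\<lambda>\<omega>. S \<omega> + H \<omega>) \<in> C \<longrightarrow>
        \<rho> (\<lambda>\<omega>. S \<omega> + H \<omega>) = \<rho> S + \<beta> \<bullet> y)"

text \<open>
  The risk margin \<open>RM\<close> must not depend on the current prices. This is a condition on the
  valuation as a function of the price vector: one and the same \<open>RM\<close> serves for all prices.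
\<close>
definition actuarial ::
    "'a measure \<Rightarrow> real \<Rightarrow> ('a \<Rightarrow> real) set \<Rightarrow> ('a \<Rightarrow> ('n::finite) assets) \<Rightarrow>
      ('n assets \<Rightarrow> ('a \<Rightarrow> real) \<Rightarrow> real) \<Rightarrow> bool" where
  "actuarial M r C Y \<rho> \<longleftrightarrow>
     (\<exists>RM. \<forall>y\<in>admissible_prices. \<forall>S\<in>orthogonal_claims M C Y.
        \<rho> y S = exp (- r) * integral\<^sup>L M S + RM S)"

definition fair ::
    "'a measure \<Rightarrow> real \<Rightarrow> ('a \<Rightarrow> real) set \<Rightarrow> ('a \<Rightarrow> ('n::finite) assets) \<Rightarrow>
      ('n assets \<Rightarrow> ('a \<Rightarrow> real) \<Rightarrow> real) \<Rightarrow> bool" where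
  "fair M r C Y \<rho> \<longleftrightarrow>
     (\<forall>y\<in>admissible_prices. market_consistent M C Y y (\<rho> y)) \<and> actuarial M r C Y \<rho>"

definition expectile_loss :: "real \<Rightarrow> real \<Rightarrow> real" where
  "expectile_loss \<tau> x = \<tau> * (max x 0)\<^sup>2 + (1 - \<tau>) * (max (- x) 0)\<^sup>2"

definition hedging_loss ::
    "(real \<Rightarrow> real) \<Rightarrow> 'a measure \<Rightarrow> ('a \<Rightarrow> ('n::finite) assets) \<Rightarrow> ('a \<Rightarrow> real) \<Rightarrow> 'n assets \<Rightarrow> real"
  where
  "hedging_loss l M Y S \<beta> = (\<integral>\<omega>. l (S \<omega> - \<beta> \<bullet> Y \<omega>) \<partial>M)"

definition mean_hedge ::
    "'a measure \<Rightarrow> ('a \<Rightarrow> ('n::finite) assets) \<Rightarrow> ('a \<Rightarrow> real) \<Rightarrow> 'n assets" where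
  "mean_hedge M Y S = arg_min (hedging_loss (\<lambda>x. x\<^sup>2) M Y S) (\<lambda>\<beta>. True)"

definition hedging_residual ::
    "'a measure \<Rightarrow> ('a \<Rightarrow> ('n::finite) assets) \<Rightarrow> ('a \<Rightarrow> real) \<Rightarrow> 'a \<Rightarrow> real" where
  "hedging_residual M Y S = (\<lambda>\<omega>. S \<omega> - mean_hedge M Y S \<bullet> Y \<omega>)"

definition expectile_hedge ::
    "real \<Rightarrow> 'a measure \<Rightarrow> ('a \<Rightarrow> ('n::finite) assets) \<Rightarrow> ('a \<Rightarrow> real) \<Rightarrow> 'n assets" where
  "expectile_hedge \<tau> M Y S =
     arg_min (hedging_loss (expectile_loss \<tau>) M Y (hedging_residual M Y S)) (\<lambda>\<beta>. True)"

definition mean_expectile_valuation ::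
    "real \<Rightarrow> real \<Rightarrow> 'a measure \<Rightarrow> ('a \<Rightarrow> ('n::finite) assets) \<Rightarrow> 'n assets \<Rightarrow> ('a \<Rightarrow> real) \<Rightarrow> real"
  where
  "mean_expectile_valuation \<tau> i M Y y S =
     mean_hedge M Y S \<bullet> y + i * (expectile_hedge \<tau> M Y S \<bullet> y)"

end

theory Submission
  imports Defs
begin

text \<open>
  The square loss and the expectile loss are both of the form \<open>a (max x 0)\<^sup>2 + b (max (- x) 0)\<^sup>2\<close>
  with \<open>a, b > 0\<close>. Such a loss lies between the quadratics with leading coefficients \<open>min a b\<close> and
  \<open>max a b\<close> tangent to it at any point; with non-redundancy this makes the expected hedging error
  coercive and strictly convex, and its unique minimiser is the solution of the first-order
  condition. This condition is equivariant under adding hedgeable payoffs and under positive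
  scaling. For a claim independent of the assets it factorises, so that it is solved by a position
  in the risk-free asset alone, whose price does not depend on those of the risky assets.
\<close>

section \<open>Closure properties of square-integrable functions\<close>

lemma square_integrable_measurable:
  "S \<in> square_integrable M \<Longrightarrow> S \<in> borel_measurable M"
  by (simp add: square_integrable_def)

lemma square_integrable_bound:
  assumes "S \<in> square_integrable M" "T \<in> borel_measurable M"
    and "\<And>\<omega>. \<bar>T \<omega>\<bar> \<le> c * \<bar>S \<omega>\<bar>"
  shows "T \<in> square_integrable M"
proof -
  have "integrable M (\<lambda>\<omega>. c\<^sup>2 * (S \<omega>)\<^sup>2)"
    using assms(1) by (simp add: square_integrable_def)
  then have "integrable M (\<lambda>\<omega>. (T \<omega>)\<^sup>2)"
  proof (rule Bochner_Integration.integrable_bound)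
    show "(\<lambda>\<omega>. (T \<omega>)\<^sup>2) \<in> borel_measurable M"
      using assms(2) by measurable
    have "(T \<omega>)\<^sup>2 \<le> c\<^sup>2 * (S \<omega>)\<^sup>2" for \<omega>
      using power_mono[OF assms(3)[of \<omega>] abs_ge_zero, of 2] by (simp add: power_mult_distrib)
    then show "AE \<omega> in M. norm ((T \<omega>)\<^sup>2) \<le> norm (c\<^sup>2 * (S \<omega>)\<^sup>2)"
      by simp
  qed
  then show ?thesis
    using assms(2) by (simp add: square_integrable_def)
qed

lemma square_integrable_scale:
  "S \<in> square_integrable M \<Longrightarrow> (\<lambda>\<omega>. c * S \<omega>) \<in> square_integrable M"
  by (auto simp: square_integrable_def power_mult_distrib)

lemma integrable_mult_of_square_integrable:
  assumes "S \<in> square_integrable M" "T \<in> square_integrable M"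
  shows "integrable M (\<lambda>\<omega>. S \<omega> * T \<omega>)"
proof (rule Bochner_Integration.integrable_bound)
  show "integrable M (\<lambda>\<omega>. (S \<omega>)\<^sup>2 + (T \<omega>)\<^sup>2)"
    using assms by (simp add: square_integrable_def)
  show "(\<lambda>\<omega>. S \<omega> * T \<omega>) \<in> borel_measurable M"
    using assms by (auto simp: square_integrable_def)
  have "\<bar>x * y\<bar> \<le> x\<^sup>2 + y\<^sup>2" for x y :: real
    using sum_squares_bound[of x y] sum_squares_bound[of x "-y"] zero_le_power2[of x] zero_le_power2[of y]
    by (simp add: abs_le_iff)
  then show "AE \<omega> in M. norm (S \<omega> * T \<omega>) \<le> norm ((S \<omega>)\<^sup>2 + (T \<omega>)\<^sup>2)"
    by simp
qed

lemma square_integrable_add: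
  assumes "S \<in> square_integrable M" "T \<in> square_integrable M"
  shows "(\<lambda>\<omega>. S \<omega> + T \<omega>) \<in> square_integrable M"
  using assms integrable_mult_of_square_integrable[OF assms]
  by (auto simp: square_integrable_def power2_sum mult.assoc)

lemma square_integrable_diff:
  assumes "S \<in> square_integrable M" "T \<in> square_integrable M"
  shows "(\<lambda>\<omega>. S \<omega> - T \<omega>) \<in> square_integrable M"
  using square_integrable_add[OF assms(1) square_integrable_scale[OF assms(2), of "-1"]] by simp

lemma square_integrable_sum:
  assumes "\<And>i. i \<in> I \<Longrightarrow> f i \<in> square_integrable M"
  shows "(\<lambda>\<omega>. \<Sum>i\<in>I. f i \<omega>) \<in> square_integrable M"
  using assms
proof (induction I rule: infinite_finite_induct)
  case (insert i I)
  then show ?case by (simp add: square_integrable_add)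
qed (auto simp: square_integrable_def)

lemma (in finite_measure) square_integrable_const: "(\<lambda>_. c) \<in> square_integrable M"
  by (simp add: square_integrable_def)

lemma (in finite_measure) integrable_of_square_integrable:
  assumes "S \<in> square_integrable M" shows "integrable M S"
  using integrable_mult_of_square_integrable[OF assms square_integrable_const[of 1]] by simp

section \<open>The asymmetric square loss and its quadratic bounds\<close>

definition asym_square :: "real \<Rightarrow> real \<Rightarrow> real \<Rightarrow> real" where
  "asym_square a b x = a * (max x 0)\<^sup>2 + b * (max (- x) 0)\<^sup>2"

text \<open>Half the derivative of the loss.\<close>
definition asym_slope :: "real \<Rightarrow> real \<Rightarrow> real \<Rightarrow> real" where
  "asym_slope a b x = a * max x 0 - b * max (- x) 0"

lemma asym_square_eq:
  "asym_square a b x = (if 0 \<le> x then a * x\<^sup>2 else b * x\<^sup>2)"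
  by (auto simp: asym_square_def max_def)

lemma asym_slope_eq: "asym_slope a b x = (if 0 \<le> x then a * x else b * x)"
  by (auto simp: asym_slope_def max_def)

lemma asym_square_1_1: "asym_square 1 1 = (\<lambda>x. x\<^sup>2)"
  by (auto simp: asym_square_eq)

lemma asym_slope_1_1: "asym_slope 1 1 x = x"
  by (auto simp: asym_slope_eq)

lemma expectile_loss_eq_asym_square: "expectile_loss \<tau> = asym_square \<tau> (1 - \<tau>)"
  by (auto simp: expectile_loss_def asym_square_def)

lemma asym_slope_scale: "0 \<le> c \<Longrightarrow> asym_slope a b (c * x) = c * asym_slope a b x"
  by (auto simp: asym_slope_eq zero_le_mult_iff)

lemma borel_measurable_asym_slope [measurable]: "asym_slope a b \<in> borel_measurable borel"
  unfolding asym_slope_def by measurable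

text \<open>On the same side of 0, the gap between the two sides is a nonnegative multiple of the
  squared step. On opposite sides the product of the two points is at most 0, and the gap splits
  into three nonnegative terms. No sign is imposed on \<open>m\<close>, \<open>a\<close>,
  \<open>b\<close>; the upper bound relies on this.\<close>

lemma asym_square_tangent_lower:
  assumes "m \<le> a" "m \<le> b"
  shows "asym_square a b x + 2 * asym_slope a b x * h + m * h\<^sup>2 \<le> asym_square a b (x + h)"
proof -
  define w where "w = x + h"
  have h: "h = w - x" by (simp add: w_def)
  define p where "p = - (x * w)"
  have diff: "asym_square a b w - (asym_square a b x + 2 * asym_slope a b x * h + m * h\<^sup>2) =
      (if 0 \<le> x
       then if 0 \<le> w then (a - m) * (w - x)\<^sup>2
         else (b - m) * w\<^sup>2 + (a - m) * x\<^sup>2 + 2 * ((a - m) * p)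
       else if 0 \<le> w then (a - m) * w\<^sup>2 + (b - m) * x\<^sup>2 + 2 * ((b - m) * p)
         else (b - m) * (w - x)\<^sup>2)"
    by (simp add: asym_square_eq asym_slope_eq h p_def power2_eq_square algebra_simps)
  have "0 \<le> p" if "(0 \<le> x) \<noteq> (0 \<le> w)"
    using that by (auto simp: p_def mult_le_0_iff)
  then have "0 \<le> asym_square a b w - (asym_square a b x + 2 * asym_slope a b x * h + m * h\<^sup>2)"
    unfolding diff using assms by (auto intro!: add_nonneg_nonneg mult_nonneg_nonneg)
  then show ?thesis
    by (simp add: w_def)
qed

text \<open>Negating the three coefficients negates loss and slope, so this is the lower bound for
  \<open>- m\<close>, \<open>- a\<close>, \<open>- b\<close>.\<close>

lemma asym_square_tangent_upper:
  assumes "a \<le> m" "b \<le> m"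
  shows "asym_square a b (x + h) \<le> asym_square a b x + 2 * asym_slope a b x * h + m * h\<^sup>2"
  using asym_square_tangent_lower[of "- m" "- a" "- b" x h] assms
  by (auto simp: asym_square_eq asym_slope_eq split: if_splits)

lemma convex_asym_square:
  assumes "0 \<le> a" "0 \<le> b" shows "convex_on UNIV (asym_square a b)"
proof (rule convex_onI)
  fix t x y :: real assume t: "0 < t" "t < 1"
  \<comment> \<open>The supporting lines are taken at the convex combination itself, where their
    linear parts average to zero.\<close>
  define u where "u = (1 - t) * x + t * y"
  have xu: "asym_square a b u + 2 * asym_slope a b u * (x - u) \<le> asym_square a b x"
    and yu: "asym_square a b u + 2 * asym_slope a b u * (y - u) \<le> asym_square a b y"
    using asym_square_tangent_lower[of 0 a b u "x - u"] asym_square_tangent_lower[of 0 a b u "y - u"]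
      assms by auto
  have "asym_square a b u = (1 - t) * (asym_square a b u + 2 * asym_slope a b u * (x - u))
      + t * (asym_square a b u + 2 * asym_slope a b u * (y - u))"
    by (simp add: u_def algebra_simps)
  also have "\<dots> \<le> (1 - t) * asym_square a b x + t * asym_square a b y"
    using t xu yu by (intro add_mono mult_left_mono) auto
  finally show "asym_square a b ((1 - t) *\<^sub>R x + t *\<^sub>R y)
      \<le> (1 - t) * asym_square a b x + t * asym_square a b y"
    by (simp add: u_def)
qed auto

lemma asym_slope_square_integrable:
  assumes "S \<in> square_integrable M"
  shows "(\<lambda>\<omega>. asym_slope a b (S \<omega>)) \<in> square_integrable M"
proof (rule square_integrable_bound[OF assms])
  show "(\<lambda>\<omega>. asym_slope a b (S \<omega>)) \<in> borel_measurable M"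
    using assms[THEN square_integrable_measurable] by measurable
  show "\<bar>asym_slope a b (S \<omega>)\<bar> \<le> max \<bar>a\<bar> \<bar>b\<bar> * \<bar>S \<omega>\<bar>" for \<omega>
    by (auto simp: asym_slope_eq abs_mult intro!: mult_right_mono)
qed

lemma asym_square_integrable:
  assumes "S \<in> square_integrable M"
  shows "integrable M (\<lambda>\<omega>. asym_square a b (S \<omega>))"
proof -
  have "asym_square a b x = asym_slope a b x * x" for x
    by (simp add: asym_square_eq asym_slope_eq power2_eq_square)
  then show ?thesis
    using integrable_mult_of_square_integrable[OF asym_slope_square_integrable[OF assms] assms]
    by simp
qed

section \<open>Asymmetric least-squares regression on square-integrable regressors\<close>

locale l2_regressors =
  fixes M :: "'a measure" and Y :: "'a \<Rightarrow> 'b::euclidean_space"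
  assumes inner_square_integrable: "(\<lambda>\<omega>. \<beta> \<bullet> Y \<omega>) \<in> square_integrable M"
    and nondegenerate: "(AE \<omega> in M. \<beta> \<bullet> Y \<omega> = 0) \<Longrightarrow> \<beta> = 0"
begin

definition risk :: "real \<Rightarrow> real \<Rightarrow> ('a \<Rightarrow> real) \<Rightarrow> 'b \<Rightarrow> real" where
  "risk a b S \<beta> = (\<integral>\<omega>. asym_square a b (S \<omega> - \<beta> \<bullet> Y \<omega>) \<partial>M)"

definition second_moment :: "'b \<Rightarrow> real" where
  "second_moment \<beta> = (\<integral>\<omega>. (\<beta> \<bullet> Y \<omega>)\<^sup>2 \<partial>M)"

text \<open>The integral is the derivative of \<open>risk a b S\<close> at \<open>\<beta>\<close> in
  direction \<open>h\<close>, up to the factor \<open>- 2\<close>. Unlike the minimisation problem,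
  it can be transported from one claim to another by rewriting the integrand.\<close>

definition stationary :: "real \<Rightarrow> real \<Rightarrow> ('a \<Rightarrow> real) \<Rightarrow> 'b \<Rightarrow> bool" where
  "stationary a b S \<beta> \<longleftrightarrow>
     (\<forall>h. (\<integral>\<omega>. asym_slope a b (S \<omega> - \<beta> \<bullet> Y \<omega>) * (h \<bullet> Y \<omega>) \<partial>M) = 0)"

lemma residual_square_integrable:
  "S \<in> square_integrable M \<Longrightarrow> (\<lambda>\<omega>. S \<omega> - \<beta> \<bullet> Y \<omega>) \<in> square_integrable M"
  by (intro square_integrable_diff inner_square_integrable)

lemma integrable_second_moment: "integrable M (\<lambda>\<omega>. (\<beta> \<bullet> Y \<omega>)\<^sup>2)"
  using inner_square_integrable by (simp add: square_integrable_def)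

lemma second_moment_pos:
  assumes "\<beta> \<noteq> 0" shows "0 < second_moment \<beta>"
proof -
  have "second_moment \<beta> \<noteq> 0"
    using integral_nonneg_eq_0_iff_AE[OF integrable_second_moment[of \<beta>]] nondegenerate[of \<beta>] assms
    by (auto simp: second_moment_def)
  then show ?thesis
    by (simp add: second_moment_def less_le)
qed

lemma convex_risk:
  assumes "0 \<le> a" "0 \<le> b" "S \<in> square_integrable M"
  shows "convex_on UNIV (risk a b S)"
proof (rule convex_onI)
  fix t :: real and x y :: 'b assume t: "0 < t" "t < 1"
  note int = asym_square_integrable[OF residual_square_integrable[OF assms(3)]]
  have "asym_square a b (S \<omega> - ((1 - t) *\<^sub>R x + t *\<^sub>R y) \<bullet> Y \<omega>)
      \<le> (1 - t) * asym_square a b (S \<omega> - x \<bullet> Y \<omega>) + t * asym_square a b (S \<omega> - y \<bullet> Y \<omega>)" for \<omega>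
    using convex_onD[OF convex_asym_square[OF assms(1,2)], of t "S \<omega> - x \<bullet> Y \<omega>" "S \<omega> - y \<bullet> Y \<omega>"] t
    by (simp add: algebra_simps)
  then have "risk a b S ((1 - t) *\<^sub>R x + t *\<^sub>R y)
      \<le> (\<integral>\<omega>. (1 - t) * asym_square a b (S \<omega> - x \<bullet> Y \<omega>) + t * asym_square a b (S \<omega> - y \<bullet> Y \<omega>) \<partial>M)"
    unfolding risk_def by (intro integral_mono) (auto intro!: int)
  then show "risk a b S ((1 - t) *\<^sub>R x + t *\<^sub>R y) \<le> (1 - t) * risk a b S x + t * risk a b S y"
    unfolding risk_def by (simp add: int)
qed auto

text \<open>Read as a risk, the second moment is convex, hence continuous in finite dimension, with
  no limit taken under the integral.\<close>

lemma second_moment_eq_risk: "second_moment = risk 1 1 (\<lambda>_. 0)"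
  by (auto simp: second_moment_def risk_def asym_square_1_1)

lemma zero_square_integrable: "(\<lambda>_. 0) \<in> square_integrable M"
  by (simp add: square_integrable_def)

lemma continuous_second_moment: "continuous_on UNIV second_moment"
  unfolding second_moment_eq_risk
  by (intro convex_on_continuous open_UNIV convex_risk zero_square_integrable) auto

text \<open>The constant is the minimum over the compact unit sphere, positive by nondegeneracy;
  homogeneity of degree two extends the bound to all vectors.\<close>

lemma second_moment_coercive:
  obtains k where "0 < k" "\<And>\<beta>. k * (norm \<beta>)\<^sup>2 \<le> second_moment \<beta>"
proof -
  have "sphere (0::'b) 1 \<noteq> {}" by simp
  then obtain \<beta>0 where \<beta>0: "norm \<beta>0 = 1" "\<And>\<beta>. norm \<beta> = 1 \<Longrightarrow> second_moment \<beta>0 \<le> second_moment \<beta>"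
    using continuous_attains_inf[OF compact_sphere _ continuous_on_subset[OF continuous_second_moment]]
    by (metis mem_sphere_0 subset_UNIV)
  have "second_moment \<beta>0 * (norm \<beta>)\<^sup>2 \<le> second_moment \<beta>" for \<beta>
  proof (cases "\<beta> = 0")
    case False
    have "second_moment \<beta> = (norm \<beta>)\<^sup>2 * second_moment (\<beta> /\<^sub>R norm \<beta>)"
      using False by (simp add: second_moment_def power_mult_distrib power_inverse)
    then show ?thesis
      using \<beta>0(2)[of "\<beta> /\<^sub>R norm \<beta>"] False by (simp add: mult.commute mult_left_mono)
  qed (simp add: second_moment_def)
  moreover have "0 < second_moment \<beta>0"
    using second_moment_pos[of \<beta>0] \<beta>0(1) by force
  ultimately show ?thesis
    using that by blast
qed

lemma risk_coercive:
  assumes "m \<le> a" "m \<le> b" "0 \<le> m" "S \<in> square_integrable M"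
  shows "m * (second_moment \<beta> / 2 - (\<integral>\<omega>. (S \<omega>)\<^sup>2 \<partial>M)) \<le> risk a b S \<beta>"
proof -
  have S: "integrable M (\<lambda>\<omega>. (S \<omega>)\<^sup>2)"
    using assms(4) by (simp add: square_integrable_def)
  have "m * ((\<beta> \<bullet> Y \<omega>)\<^sup>2 / 2 - (S \<omega>)\<^sup>2) \<le> asym_square a b (S \<omega> - \<beta> \<bullet> Y \<omega>)" for \<omega>
  proof -
    \<comment> \<open>The difference of the two sides is half the square of
      \<open>2 * S \<omega> - \<beta> \<bullet> Y \<omega>\<close>.\<close>
    have "(\<beta> \<bullet> Y \<omega>)\<^sup>2 / 2 - (S \<omega>)\<^sup>2 \<le> (S \<omega> - \<beta> \<bullet> Y \<omega>)\<^sup>2"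
      using zero_le_power2[of "2 * S \<omega> - \<beta> \<bullet> Y \<omega>"] by (simp add: power2_eq_square algebra_simps)
    then have "m * ((\<beta> \<bullet> Y \<omega>)\<^sup>2 / 2 - (S \<omega>)\<^sup>2) \<le> m * (S \<omega> - \<beta> \<bullet> Y \<omega>)\<^sup>2"
      using assms(3) by (rule mult_left_mono)
    also have "\<dots> \<le> asym_square a b (S \<omega> - \<beta> \<bullet> Y \<omega>)"
      using asym_square_tangent_lower[OF assms(1,2), of 0 "S \<omega> - \<beta> \<bullet> Y \<omega>"]
      by (simp add: asym_square_eq asym_slope_eq)
    finally show ?thesis .
  qed
  then have "(\<integral>\<omega>. m * ((\<beta> \<bullet> Y \<omega>)\<^sup>2 / 2 - (S \<omega>)\<^sup>2) \<partial>M) \<le> risk a b S \<beta>"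
    unfolding risk_def
    by (intro integral_mono asym_square_integrable residual_square_integrable assms(4))
      (auto intro!: S integrable_second_moment)
  then show ?thesis
    using S integrable_second_moment[of \<beta>] by (simp add: second_moment_def)
qed

text \<open>Every strategy that does at least as well as 0 lies in a fixed ball. A minimiser over
  this compact ball is therefore global: outside the ball the risk exceeds that of 0, which the ball
  contains.\<close>

lemma risk_minimizer_exists:
  assumes "0 < a" "0 < b" "S \<in> square_integrable M"
  shows "\<exists>\<beta>. \<forall>\<gamma>. risk a b S \<beta> \<le> risk a b S \<gamma>"
proof -
  obtain k where k: "0 < k" "\<And>\<beta>. k * (norm \<beta>)\<^sup>2 \<le> second_moment \<beta>"
    using second_moment_coercive by blast
  define m where "m = min a b"
  have m: "m \<le> a" "m \<le> b" "0 < m"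
    using assms by (auto simp: m_def)
  \<comment> \<open>Obtained by solving the two coercivity estimates for the squared norm.\<close>
  define K where "K = 2 * (risk a b S 0 / m + (\<integral>\<omega>. (S \<omega>)\<^sup>2 \<partial>M)) / k"
  have bound: "norm \<beta> \<le> sqrt K" if "risk a b S \<beta> \<le> risk a b S 0" for \<beta>
  proof -
    have "m * (second_moment \<beta> / 2 - (\<integral>\<omega>. (S \<omega>)\<^sup>2 \<partial>M)) \<le> risk a b S 0"
      using risk_coercive[OF m(1,2) _ assms(3), of \<beta>] m(3) that by simp
    then have "second_moment \<beta> \<le> 2 * (risk a b S 0 / m + (\<integral>\<omega>. (S \<omega>)\<^sup>2 \<partial>M))"
      using m(3) by (simp add: field_simps)
    then have "k * (norm \<beta>)\<^sup>2 \<le> 2 * (risk a b S 0 / m + (\<integral>\<omega>. (S \<omega>)\<^sup>2 \<partial>M))"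
      using k(2)[of \<beta>] by linarith
    then have "(norm \<beta>)\<^sup>2 \<le> K"
      using k(1) by (simp add: K_def field_simps)
    then show ?thesis by (rule real_le_rsqrt)
  qed
  have "continuous_on UNIV (risk a b S)"
    using assms by (intro convex_on_continuous open_UNIV convex_risk) auto
  then have "continuous_on (cball 0 (sqrt K)) (risk a b S)"
    by (rule continuous_on_subset) simp
  \<comment> \<open>The bound at 0 itself shows that the radius is nonnegative.\<close>
  moreover have 0: "0 \<in> cball (0::'b) (sqrt K)"
    using bound[of 0] by simp
  ultimately obtain \<beta> where \<beta>: "\<forall>\<gamma>\<in>cball 0 (sqrt K). risk a b S \<beta> \<le> risk a b S \<gamma>"
    using continuous_attains_inf[OF compact_cball] by (metis empty_iff)
  have "risk a b S \<beta> \<le> risk a b S \<gamma>" for \<gamma>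
    using bound[of \<gamma>] \<beta> 0 by (meson linear mem_cball_0 order_trans)
  then show ?thesis by blast
qed

text \<open>These are the pointwise tangent bounds at the residual, integrated. Moving the strategy
  by \<open>h\<close> moves the residual by \<open>- (h \<bullet> Y \<omega>)\<close>, whence the
  minus sign of the linear term.\<close>

lemma
  fixes a b :: real
  assumes "S \<in> square_integrable M"
  defines "d \<equiv> \<lambda>\<beta> h. \<integral>\<omega>. asym_slope a b (S \<omega> - \<beta> \<bullet> Y \<omega>) * (h \<bullet> Y \<omega>) \<partial>M"
  shows risk_tangent_lower:
      "\<lbrakk>m \<le> a; m \<le> b\<rbrakk> \<Longrightarrow> risk a b S \<beta> - 2 * d \<beta> h + m * second_moment h \<le> risk a b S (\<beta> + h)"
    and risk_tangent_upper:
      "\<lbrakk>a \<le> m; b \<le> m\<rbrakk> \<Longrightarrow> risk a b S (\<beta> + h) \<le> risk a b S \<beta> - 2 * d \<beta> h + m * second_moment h"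
proof -
  let ?u = "\<lambda>\<omega>. S \<omega> - \<beta> \<bullet> Y \<omega>"
  let ?T = "\<lambda>\<omega>. asym_square a b (?u \<omega>) - 2 * (asym_slope a b (?u \<omega>) * (h \<bullet> Y \<omega>)) + m * (h \<bullet> Y \<omega>)\<^sup>2"
  note int = asym_square_integrable[OF residual_square_integrable[OF assms(1)]]
    integrable_mult_of_square_integrable[OF asym_slope_square_integrable
      [OF residual_square_integrable[OF assms(1)]] inner_square_integrable]
    integrable_second_moment
  have T: "integrable M ?T"
    by (intro Bochner_Integration.integrable_add Bochner_Integration.integrable_diff integrable_mult_right int)
  have int_T: "integral\<^sup>L M ?T = risk a b S \<beta> - 2 * d \<beta> h + m * second_moment h"
    by (simp add: risk_def d_def second_moment_def int)
  show "risk a b S \<beta> - 2 * d \<beta> h + m * second_moment h \<le> risk a b S (\<beta> + h)" if m: "m \<le> a" "m \<le> b"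
  proof -
    have "?T \<omega> \<le> asym_square a b (S \<omega> - (\<beta> + h) \<bullet> Y \<omega>)" for \<omega>
      using asym_square_tangent_lower[OF m, of "?u \<omega>" "- (h \<bullet> Y \<omega>)"]
      by (simp add: inner_add_left algebra_simps)
    then show ?thesis
      unfolding int_T[symmetric] risk_def[of a b S "\<beta> + h"] by (intro integral_mono T int)
  qed
  show "risk a b S (\<beta> + h) \<le> risk a b S \<beta> - 2 * d \<beta> h + m * second_moment h" if m: "a \<le> m" "b \<le> m"
  proof -
    have "asym_square a b (S \<omega> - (\<beta> + h) \<bullet> Y \<omega>) \<le> ?T \<omega>" for \<omega>
      using asym_square_tangent_upper[OF m, of "?u \<omega>" "- (h \<bullet> Y \<omega>)"]
      by (simp add: inner_add_left algebra_simps)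
    then show ?thesis
      unfolding int_T[symmetric] risk_def[of a b S "\<beta> + h"] by (intro integral_mono T int)
  qed
qed

text \<open>At a stationary point the linear term of the lower bound vanishes, and a positive
  quadratic term remains.\<close>

lemma risk_strict_of_stationary:
  assumes "0 < a" "0 < b" "S \<in> square_integrable M" "stationary a b S \<beta>" "\<gamma> \<noteq> \<beta>"
  shows "risk a b S \<beta> < risk a b S \<gamma>"
proof -
  have "risk a b S \<beta> + min a b * second_moment (\<gamma> - \<beta>) \<le> risk a b S \<gamma>"
    using risk_tangent_lower[OF assms(3), of "min a b" a b \<beta> "\<gamma> - \<beta>"] assms(4)
    by (simp add: stationary_def)
  moreover have "0 < min a b * second_moment (\<gamma> - \<beta>)"
    using assms second_moment_pos[of "\<gamma> - \<beta>"] by (intro mult_pos_pos) auto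
  ultimately show ?thesis by linarith
qed

text \<open>Along a line the upper bound is a quadratic in the step \<open>t\<close>, which
  minimality keeps above its value at 0; this forces its linear coefficient to vanish. No
  differentiation under the integral is involved.\<close>

lemma stationary_of_minimizer:
  assumes "S \<in> square_integrable M" "\<And>\<gamma>. risk a b S \<beta> \<le> risk a b S \<gamma>"
  shows "stationary a b S \<beta>"
  unfolding stationary_def
proof
  fix h
  let ?D = "\<integral>\<omega>. asym_slope a b (S \<omega> - \<beta> \<bullet> Y \<omega>) * (h \<bullet> Y \<omega>) \<partial>M"
  \<comment> \<open>The inner maximum with 1 makes the coefficient positive whatever
    \<open>a\<close> and \<open>b\<close> are, and the summand 1 keeps \<open>c\<close> positive
    when the second moment is 0.\<close>
  define c where "c = max 1 (max a b) * second_moment h + 1"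
  have "0 \<le> second_moment h"
    by (simp add: second_moment_def)
  then have c: "0 < c" "max 1 (max a b) * second_moment h \<le> c"
    by (auto simp: c_def intro!: add_nonneg_pos mult_nonneg_nonneg)
  have "2 * t * ?D \<le> t\<^sup>2 * c" for t
  proof -
    have "second_moment (t *\<^sub>R h) = t\<^sup>2 * second_moment h"
      by (simp add: second_moment_def power_mult_distrib)
    then have "0 \<le> - 2 * t * ?D + t\<^sup>2 * (max 1 (max a b) * second_moment h)"
      using risk_tangent_upper[OF assms(1), of a "max 1 (max a b)" b \<beta> "t *\<^sub>R h"]
        assms(2)[of "\<beta> + t *\<^sub>R h"] by (simp add: le_max_iff_disj mult.left_commute mult.assoc)
    then show ?thesis
      using mult_left_mono[OF c(2), of "t\<^sup>2"] by simp
  qed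
  \<comment> \<open>This step minimises the quadratic
    \<open>t\<^sup>2 * c - 2 * t * ?D\<close>.\<close>
  from this[of "?D / c"] have "?D\<^sup>2 \<le> 0"
    using c(1) by (simp add: power2_eq_square field_simps)
  then show "?D = 0" by simp
qed

text \<open>Of two distinct stationary points, each would have strictly smaller risk than the
  other.\<close>

lemma ex1_stationary:
  assumes "0 < a" "0 < b" "S \<in> square_integrable M"
  shows "\<exists>!\<beta>. stationary a b S \<beta>"
  using risk_minimizer_exists[OF assms] stationary_of_minimizer[OF assms(3)]
    risk_strict_of_stationary[OF assms] by (metis less_asym)

lemma is_arg_min_risk_iff:
  assumes "0 < a" "0 < b" "S \<in> square_integrable M"
  shows "is_arg_min (risk a b S) (\<lambda>\<beta>. True) \<beta> \<longleftrightarrow> stationary a b S \<beta>"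
  using stationary_of_minimizer[OF assms(3)] risk_strict_of_stationary[OF assms]
  unfolding is_arg_min_def by (metis less_asym not_le)

text \<open>Uniqueness turns the arbitrary choice made by \<open>arg_min\<close> into a
  characterisation.\<close>

lemma arg_min_risk_eq_iff:
  assumes "0 < a" "0 < b" "S \<in> square_integrable M"
  shows "arg_min (risk a b S) (\<lambda>\<beta>. True) = \<beta> \<longleftrightarrow> stationary a b S \<beta>"
  using ex1_stationary[OF assms] unfolding arg_min_def is_arg_min_risk_iff[OF assms]
  by (metis someI_ex)

text \<open>The residual is unchanged almost surely. With \<open>\<beta> = 0\<close> this also
  covers a change of representative.\<close>

lemma stationary_translate:
  assumes "AE \<omega> in M. T \<omega> = S \<omega> + \<beta> \<bullet> Y \<omega>" "stationary a b S \<gamma>"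
    "S \<in> borel_measurable M" "T \<in> borel_measurable M"
  shows "stationary a b T (\<gamma> + \<beta>)"
  unfolding stationary_def
proof
  fix h
  note [measurable] = assms(3,4) inner_square_integrable[THEN square_integrable_measurable]
  have "(\<integral>\<omega>. asym_slope a b (T \<omega> - (\<gamma> + \<beta>) \<bullet> Y \<omega>) * (h \<bullet> Y \<omega>) \<partial>M)
      = (\<integral>\<omega>. asym_slope a b (S \<omega> - \<gamma> \<bullet> Y \<omega>) * (h \<bullet> Y \<omega>) \<partial>M)"
    using assms(1) by (intro integral_cong_AE) (measurable, auto simp: inner_add_left)
  then show "(\<integral>\<omega>. asym_slope a b (T \<omega> - (\<gamma> + \<beta>) \<bullet> Y \<omega>) * (h \<bullet> Y \<omega>) \<partial>M) = 0"
    using assms(2) by (simp add: stationary_def)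
qed

text \<open>The slope is only positively homogeneous: a negative factor would exchange the roles of
  \<open>a\<close> and \<open>b\<close>.\<close>

lemma stationary_scale:
  assumes "0 \<le> c" "stationary a b S \<gamma>"
  shows "stationary a b (\<lambda>\<omega>. c * S \<omega>) (c *\<^sub>R \<gamma>)"
  using assms by (simp add: stationary_def asym_slope_scale mult.assoc flip: right_diff_distrib)

end

section \<open>Expectiles and independence\<close>

lemma (in prob_space) ex_asymmetric_mean:
  assumes "0 < a" "0 < b" "S \<in> square_integrable M"
  shows "\<exists>c. expectation (\<lambda>\<omega>. asym_slope a b (S \<omega> - c)) = 0"
proof -
  \<comment> \<open>Regression on the constant 1 over the real line: stationarity in direction 1 is
    the equation defining the expectile of \<open>S\<close> at level
    \<open>a / (a + b)\<close>.\<close>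
  interpret C: l2_regressors M "\<lambda>_. 1 :: real"
    by unfold_locales (simp_all add: square_integrable_const)
  obtain c where "C.stationary a b S c"
    using C.ex1_stationary[OF assms] by blast
  then show ?thesis
    by (auto simp: C.stationary_def dest!: spec[of _ 1])
qed

text \<open>A Borel function of \<open>Z\<close> is measurable for the sigma-algebra generated by
  \<open>Z\<close>, so it generates a smaller one.\<close>

lemma sigma_sets_vimage_compose_subset:
  assumes "h \<in> borel_measurable borel"
  shows "sigma_sets X {(\<lambda>\<omega>. h (Z \<omega>)) -` A \<inter> X | A. A \<in> sets borel} \<subseteq> sets (vimage_algebra X Z borel)"
proof -
  have "Z \<in> vimage_algebra X Z borel \<rightarrow>\<^sub>M borel"
    by (rule measurable_vimage_algebra1) simp
  then have "(\<lambda>\<omega>. h (Z \<omega>)) \<in> vimage_algebra X Z borel \<rightarrow>\<^sub>M borel"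
    using assms by (rule measurable_compose)
  then show ?thesis
    using sets_image_in_sets[of "vimage_algebra X Z borel" X] by (simp add: sets_vimage_algebra)
qed

text \<open>A claim and the asset vector have different types; their images under \<open>f\<close>
  and \<open>g\<close> share one, so the product rule for expectations becomes applicable.\<close>

lemma (in prob_space) indep_var_of_indep_vimage:
  assumes "indep_set (sets (vimage_algebra (space M) X borel)) (sets (vimage_algebra (space M) Y borel))"
    and "f \<in> borel_measurable borel" "g \<in> borel_measurable borel"
    and "random_variable borel (\<lambda>\<omega>. f (X \<omega>))" "random_variable borel (\<lambda>\<omega>. g (Y \<omega>))"
  shows "indep_var borel (\<lambda>\<omega>. f (X \<omega>)) borel (\<lambda>\<omega>. g (Y \<omega>))"
proof -
  have "indep_set (sigma_sets (space M) {(\<lambda>\<omega>. f (X \<omega>)) -` A \<inter> space M | A. A \<in> sets borel})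
      (sigma_sets (space M) {(\<lambda>\<omega>. g (Y \<omega>)) -` A \<inter> space M | A. A \<in> sets borel})"
    using assms(1) sigma_sets_vimage_compose_subset[OF assms(2), of "space M" X]
      sigma_sets_vimage_compose_subset[OF assms(3), of "space M" Y]
    by (simp only: indep_sets2_eq) blast
  then show ?thesis
    using assms(4,5) by (simp add: indep_var_eq)
qed

section \<open>Hedges in the market under translation, scaling and independence\<close>

locale hedging_market = prob_space M
  for M :: "'a measure" +
  fixes Y :: "'a \<Rightarrow> ('n::finite) assets" and r :: real
  assumes riskfree: "\<omega> \<in> space M \<Longrightarrow> Y \<omega> $ None = exp r"
    and risky: "(\<lambda>\<omega>. Y \<omega> $ Some j) \<in> square_integrable M"
    and non_redundant: "non_redundant M Y"
begin

sublocale l2_regressors M Y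
proof
  fix \<beta> :: "'n assets"
  have "(\<lambda>\<omega>. Y \<omega> $ k) \<in> square_integrable M" for k
  proof (cases k)
    case None
    then show ?thesis
      using square_integrable_const[of "exp r"] riskfree
      by (auto simp: square_integrable_def cong: measurable_cong Bochner_Integration.integrable_cong)
  qed (simp add: risky)
  then show "(\<lambda>\<omega>. \<beta> \<bullet> Y \<omega>) \<in> square_integrable M"
    unfolding inner_vec_def inner_real_def by (intro square_integrable_sum square_integrable_scale)
  show "\<beta> = 0" if "AE \<omega> in M. \<beta> \<bullet> Y \<omega> = 0"
    using that non_redundant by (simp add: non_redundant_def)
qed

lemma hedging_loss_square: "hedging_loss (\<lambda>x. x\<^sup>2) M Y S = risk 1 1 S"
  by (auto simp: hedging_loss_def risk_def asym_square_1_1)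

lemma hedging_loss_expectile: "hedging_loss (expectile_loss \<tau>) M Y S = risk \<tau> (1 - \<tau>) S"
  by (auto simp: hedging_loss_def risk_def expectile_loss_eq_asym_square)

lemma hedging_residual_square_integrable:
  "S \<in> square_integrable M \<Longrightarrow> hedging_residual M Y S \<in> square_integrable M"
  unfolding hedging_residual_def by (rule residual_square_integrable)

lemma ex1_mean_hedge:
  assumes "S \<in> square_integrable M"
  shows "\<exists>!\<beta>. is_arg_min (hedging_loss (\<lambda>x. x\<^sup>2) M Y S) (\<lambda>\<beta>. True) \<beta>"
  using ex1_stationary[of 1 1, OF _ _ assms]
  by (simp add: hedging_loss_square is_arg_min_risk_iff assms)

lemma ex1_expectile_hedge:
  assumes "S \<in> square_integrable M" "0 < \<tau>" "\<tau> < 1"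
  shows "\<exists>!\<beta>. is_arg_min (hedging_loss (expectile_loss \<tau>) M Y (hedging_residual M Y S))
           (\<lambda>\<beta>. True) \<beta>"
  using ex1_stationary[of \<tau> "1 - \<tau>", OF _ _ hedging_residual_square_integrable[OF assms(1)]] assms
  by (simp add: hedging_loss_expectile is_arg_min_risk_iff hedging_residual_square_integrable)

lemma mean_hedge_eq_iff:
  assumes "S \<in> square_integrable M"
  shows "mean_hedge M Y S = \<beta> \<longleftrightarrow> stationary 1 1 S \<beta>"
  unfolding mean_hedge_def hedging_loss_square by (rule arg_min_risk_eq_iff) (simp_all add: assms)

lemma expectile_hedge_eq_iff:
  assumes "S \<in> square_integrable M" "0 < \<tau>" "\<tau> < 1"
  shows "expectile_hedge \<tau> M Y S = \<beta> \<longleftrightarrow> stationary \<tau> (1 - \<tau>) (hedging_residual M Y S) \<beta>"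
  unfolding expectile_hedge_def hedging_loss_expectile
  by (rule arg_min_risk_eq_iff) (simp_all add: assms hedging_residual_square_integrable)

lemma mean_hedge_translate:
  assumes "S \<in> square_integrable M" "T \<in> square_integrable M"
    and "AE \<omega> in M. T \<omega> = S \<omega> + \<beta> \<bullet> Y \<omega>"
  shows "mean_hedge M Y T = mean_hedge M Y S + \<beta>"
  using stationary_translate[OF assms(3)] mean_hedge_eq_iff[OF assms(1)] mean_hedge_eq_iff[OF assms(2)]
    assms(1,2)[THEN square_integrable_measurable] by blast

text \<open>The mean hedge absorbs the whole added payoff, so the residuals agree almost surely and
  the second hedge is translated by 0.\<close>

lemma expectile_hedge_translate:
  assumes "S \<in> square_integrable M" "T \<in> square_integrable M"
    and "AE \<omega> in M. T \<omega> = S \<omega> + \<beta> \<bullet> Y \<omega>" and \<tau>: "0 < \<tau>" "\<tau> < 1"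
  shows "expectile_hedge \<tau> M Y T = expectile_hedge \<tau> M Y S"
proof -
  have "AE \<omega> in M. hedging_residual M Y T \<omega> = hedging_residual M Y S \<omega> + 0 \<bullet> Y \<omega>"
    using assms(3)
    by (auto simp: hedging_residual_def mean_hedge_translate[OF assms(1-3)] inner_add_left)
  then have "stationary \<tau> (1 - \<tau>) (hedging_residual M Y T) (expectile_hedge \<tau> M Y S + 0)"
    using expectile_hedge_eq_iff[OF assms(1) \<tau>]
      assms(1,2)[THEN hedging_residual_square_integrable, THEN square_integrable_measurable]
    by (intro stationary_translate) auto
  then show ?thesis
    using expectile_hedge_eq_iff[OF assms(2) \<tau>] by simp
qed

lemma mean_hedge_scale:
  assumes "S \<in> square_integrable M" "0 \<le> c"
  shows "mean_hedge M Y (\<lambda>\<omega>. c * S \<omega>) = c *\<^sub>R mean_hedge M Y S"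
  using stationary_scale[OF assms(2)] mean_hedge_eq_iff[OF assms(1)]
    mean_hedge_eq_iff[OF square_integrable_scale[OF assms(1)]] by blast

lemma expectile_hedge_scale:
  assumes "S \<in> square_integrable M" "0 \<le> c" and \<tau>: "0 < \<tau>" "\<tau> < 1"
  shows "expectile_hedge \<tau> M Y (\<lambda>\<omega>. c * S \<omega>) = c *\<^sub>R expectile_hedge \<tau> M Y S"
proof -
  have "hedging_residual M Y (\<lambda>\<omega>. c * S \<omega>) = (\<lambda>\<omega>. c * hedging_residual M Y S \<omega>)"
    by (simp add: hedging_residual_def mean_hedge_scale[OF assms(1,2)] right_diff_distrib)
  then show ?thesis
    using stationary_scale[OF assms(2)] expectile_hedge_eq_iff[OF assms(1) \<tau>]
      expectile_hedge_eq_iff[OF square_integrable_scale[OF assms(1)] \<tau>] by metis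
qed

lemma riskfree_inner: "\<omega> \<in> space M \<Longrightarrow> axis None (exp (- r) * c) \<bullet> Y \<omega> = c"
  by (simp add: inner_axis' riskfree flip: exp_add)

text \<open>
  Independence factorises the first-order condition, so a position in the risk-free asset alone
  that is stationary in its own direction is stationary in every direction.
\<close>
lemma stationary_riskfree:
  assumes S: "S \<in> square_integrable M"
    and indep: "indep_set (sets (vimage_algebra (space M) S borel))
      (sets (vimage_algebra (space M) Y borel))"
    and c: "expectation (\<lambda>\<omega>. asym_slope a b (S \<omega> - c)) = 0"
  shows "stationary a b S (axis None (exp (- r) * c))"
  unfolding stationary_def
proof
  fix h :: "'n assets"
  have slope: "(\<lambda>\<omega>. asym_slope a b (S \<omega> - c)) \<in> square_integrable M"
    by (intro asym_slope_square_integrable square_integrable_diff S square_integrable_const)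
  have "indep_var borel (\<lambda>\<omega>. asym_slope a b (S \<omega> - c)) borel (\<lambda>\<omega>. h \<bullet> Y \<omega>)"
    using indep
    by (rule indep_var_of_indep_vimage[where f = "\<lambda>x. asym_slope a b (x - c)" and g = "\<lambda>v. h \<bullet> v"])
      (use slope inner_square_integrable in \<open>auto intro: square_integrable_measurable\<close>)
  then have "expectation (\<lambda>\<omega>. asym_slope a b (S \<omega> - c) * (h \<bullet> Y \<omega>)) = 0"
    using slope inner_square_integrable[of h] c
    by (subst indep_var_lebesgue_integral) (auto intro: integrable_of_square_integrable)
  then show "(\<integral>\<omega>. asym_slope a b (S \<omega> - axis None (exp (- r) * c) \<bullet> Y \<omega>) * (h \<bullet> Y \<omega>) \<partial>M) = 0"
    by (simp add: riskfree_inner cong: Bochner_Integration.integral_cong)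
qed

text \<open>For \<open>a = b = 1\<close> the slope is the identity, so the constant in
  \<open>stationary_riskfree\<close> is the expectation.\<close>

lemma mean_hedge_orthogonal:
  assumes "S \<in> square_integrable M"
    and "indep_set (sets (vimage_algebra (space M) S borel)) (sets (vimage_algebra (space M) Y borel))"
  shows "mean_hedge M Y S = axis None (exp (- r) * expectation S)"
  unfolding mean_hedge_eq_iff[OF assms(1)]
  by (rule stationary_riskfree[OF assms])
    (simp add: asym_slope_1_1 integrable_of_square_integrable[OF assms(1)] prob_space)

text \<open>The risk-free position is found for \<open>S\<close> itself and then carried over to the
  residual by subtracting the mean hedge, which is risk-free too.\<close>

lemma expectile_hedge_orthogonal:
  assumes S: "S \<in> square_integrable M"
    and indep: "indep_set (sets (vimage_algebra (space M) S borel))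
      (sets (vimage_algebra (space M) Y borel))"
    and \<tau>: "0 < \<tau>" "\<tau> < 1"
  shows "\<exists>c. expectile_hedge \<tau> M Y S = axis None c"
proof -
  obtain c where "expectation (\<lambda>\<omega>. asym_slope \<tau> (1 - \<tau>) (S \<omega> - c)) = 0"
    using ex_asymmetric_mean[of \<tau> "1 - \<tau>" S] S \<tau> by auto
  then have "stationary \<tau> (1 - \<tau>) S (axis None (exp (- r) * c))"
    by (rule stationary_riskfree[OF S indep])
  then have "stationary \<tau> (1 - \<tau>) (hedging_residual M Y S)
      (axis None (exp (- r) * c) + - mean_hedge M Y S)"
    using S hedging_residual_square_integrable[OF S]
    by (intro stationary_translate square_integrable_measurable) (auto simp: hedging_residual_def)
  then have "expectile_hedge \<tau> M Y S = axis None (exp (- r) * c) - mean_hedge M Y S"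
    using expectile_hedge_eq_iff[OF S \<tau>] by simp
  also have "\<dots> = axis None (exp (- r) * c - exp (- r) * expectation S)"
    by (simp add: mean_hedge_orthogonal[OF S indep] vec_eq_iff axis_def)
  finally show ?thesis ..
qed

section \<open>Properties of the valuation\<close>

lemma mean_expectile_valuation_translate:
  assumes "S \<in> square_integrable M" "T \<in> square_integrable M"
    and "AE \<omega> in M. T \<omega> = S \<omega> + \<beta> \<bullet> Y \<omega>" "0 < \<tau>" "\<tau> < 1"
  shows "mean_expectile_valuation \<tau> i M Y y T = mean_expectile_valuation \<tau> i M Y y S + \<beta> \<bullet> y"
  by (simp add: mean_expectile_valuation_def mean_hedge_translate[OF assms(1-3)]
      expectile_hedge_translate[OF assms] inner_add_left)

lemma mean_expectile_valuation_scale: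
  assumes "S \<in> square_integrable M" "0 \<le> c" "0 < \<tau>" "\<tau> < 1"
  shows "mean_expectile_valuation \<tau> i M Y y (\<lambda>\<omega>. c * S \<omega>) = c * mean_expectile_valuation \<tau> i M Y y S"
  by (simp add: mean_expectile_valuation_def mean_hedge_scale[OF assms(1,2)]
      expectile_hedge_scale[OF assms] algebra_simps)

lemma valuation_mean_expectile:
  assumes C: "C \<subseteq> square_integrable M" and \<tau>: "0 < \<tau>" "\<tau> < 1" and y: "y \<in> admissible_prices"
  shows "valuation M r C (mean_expectile_valuation \<tau> i M Y y)"
  unfolding valuation_def
proof (intro conjI ballI allI impI)
  fix S T assume "S \<in> C" "T \<in> C" "AE \<omega> in M. S \<omega> = T \<omega>"
  \<comment> \<open>A change of representative is a translation by the zero strategy.\<close>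
  then show "mean_expectile_valuation \<tau> i M Y y S = mean_expectile_valuation \<tau> i M Y y T"
    using mean_expectile_valuation_translate[of T S 0] C \<tau> by auto
next
  show "mean_expectile_valuation \<tau> i M Y y (\<lambda>\<omega>. 0) = 0"
    using mean_expectile_valuation_scale[OF zero_square_integrable, of 0] \<tau> by simp
next
  fix S a assume "S \<in> C" "(\<lambda>\<omega>. S \<omega> + a) \<in> C"
  \<comment> \<open>A deterministic amount is hedged by the risk-free asset, so cash additivity is
    an instance of translation.\<close>
  moreover have "AE \<omega> in M. S \<omega> + a = S \<omega> + axis None (exp (- r) * a) \<bullet> Y \<omega>"
    by (auto simp: riskfree_inner)
  moreover have "axis None (exp (- r) * a) \<bullet> y = exp (- r) * a"
    using y by (simp add: inner_axis' admissible_prices_def)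
  ultimately show "mean_expectile_valuation \<tau> i M Y y (\<lambda>\<omega>. S \<omega> + a)
      = mean_expectile_valuation \<tau> i M Y y S + exp (- r) * a"
    using mean_expectile_valuation_translate[of S "\<lambda>\<omega>. S \<omega> + a" "axis None (exp (- r) * a)"] C \<tau>
    by (simp add: subset_iff)
qed

lemma fair_mean_expectile:
  assumes C: "C \<subseteq> square_integrable M" and \<tau>: "0 < \<tau>" "\<tau> < 1"
  shows "fair M r C Y (mean_expectile_valuation \<tau> i M Y)"
  unfolding fair_def
proof
  show "\<forall>y\<in>admissible_prices. market_consistent M C Y y (mean_expectile_valuation \<tau> i M Y y)"
    unfolding market_consistent_def
  proof (intro ballI allI impI, elim conjE)
    fix y S H and \<beta> :: "'n assets"
    assume "S \<in> C" "AE \<omega> in M. H \<omega> = \<beta> \<bullet> Y \<omega>" "(\<lambda>\<omega>. S \<omega> + H \<omega>) \<in> C"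
    with C \<tau> show "mean_expectile_valuation \<tau> i M Y y (\<lambda>\<omega>. S \<omega> + H \<omega>)
        = mean_expectile_valuation \<tau> i M Y y S + \<beta> \<bullet> y"
      by (intro mean_expectile_valuation_translate) auto
  qed
  \<comment> \<open>Both hedges are risk-free positions, and every admissible price vector gives the
    risk-free asset price 1. The right-hand side is thus free of \<open>y\<close> and its second
    summand can serve as the risk margin.\<close>
  have "mean_expectile_valuation \<tau> i M Y y S
      = exp (- r) * expectation S + i * (expectile_hedge \<tau> M Y S $ None)"
    if y: "y \<in> admissible_prices" and S: "S \<in> orthogonal_claims M C Y" for y S
  proof -
    have S': "S \<in> square_integrable M"
      and indep: "indep_set (sets (vimage_algebra (space M) S borel))
        (sets (vimage_algebra (space M) Y borel))"
      using S C by (auto simp: orthogonal_claims_def)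
    obtain c where "expectile_hedge \<tau> M Y S = axis None c"
      using expectile_hedge_orthogonal[OF S' indep \<tau>] by blast
    then show ?thesis
      using y by (simp add: mean_expectile_valuation_def mean_hedge_orthogonal[OF S' indep]
          inner_axis' admissible_prices_def)
  qed
  then show "actuarial M r C Y (mean_expectile_valuation \<tau> i M Y)"
    unfolding actuarial_def
    by (intro exI[of _ "\<lambda>S. i * (expectile_hedge \<tau> M Y S $ None)"]) blast
qed

end

theorem theorem2p7:
  fixes M :: "'a measure"
    and r \<tau> i :: real
    and C :: "('a \<Rightarrow> real) set"
    and Y :: "'a \<Rightarrow> ('n::finite) assets"
  assumes "prob_space M"
    and "C \<subseteq> square_integrable M"
    and "r \<ge> 0"
    and "\<And>\<omega>. \<omega> \<in> space M \<Longrightarrow> Y \<omega> $ None = exp r"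
    and "\<And>j. (\<lambda>\<omega>. Y \<omega> $ Some j) \<in> C"
    and "non_redundant M Y"
    and "0 < \<tau>" "\<tau> < 1"
    and "0 < i" "i < 1"
  shows "(\<forall>S\<in>C.
            (\<exists>!\<beta>. is_arg_min (hedging_loss (\<lambda>x. x\<^sup>2) M Y S) (\<lambda>\<beta>. True) \<beta>) \<and>
            (\<exists>!\<beta>. is_arg_min (hedging_loss (expectile_loss \<tau>) M Y (hedging_residual M Y S))
                     (\<lambda>\<beta>. True) \<beta>)) \<and>
         (\<forall>y\<in>admissible_prices.
            valuation M r C (mean_expectile_valuation \<tau> i M Y y) \<and>
            positive_homogeneous C (mean_expectile_valuation \<tau> i M Y y)) \<and>
         fair M r C Y (mean_expectile_valuation \<tau> i M Y)"
proof -
  interpret hedging_market M Y r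
    using assms(1,2,4,5,6)
    by (intro hedging_market.intro hedging_market_axioms.intro) auto
  have "positive_homogeneous C (mean_expectile_valuation \<tau> i M Y y)" for y
    using assms(2,7,8) by (auto simp: positive_homogeneous_def intro!: mean_expectile_valuation_scale)
  with assms(2,7,8) show ?thesis
    by (intro conjI ballI ex1_mean_hedge ex1_expectile_hedge valuation_mean_expectile
        fair_mean_expectile) auto
qed

end
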